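(* Let $c_0=0$ and let $(\theta,\rho)$ be the global solution of the flow (F) with admissible initial datum $(\theta_0,\rho_0)$. Write $\kappa=\partial_s\theta$ and $\kappa_0=\partial_s\theta_0$. Then: (i) $\kappa_0\ge 0$ (respectively $\kappa_0\le 0$) on $[0,L]$ implies $\kappa\ge0$ (respectively $\kappa\le0$) on $[0,\infty)\times[0,L]$; (ii) $\kappa_0>0$ (respectively $\kappa_0<0$) on $[0,L]$ implies $\kappa>0$ (respectively $\kappa<0$) on $[0,\infty)\times[0,L]$.
   Context: Fixed parameters: $L>0$, $\nu\in\mathbb{R}$, $\mu>0$, $\omega\in\mathbb{Z}$, $c_0\in\mathbb{R}$, and $\beta\in C^\infty(\mathbb{R})$ with $\beta>0$. A function $\theta:[0,L]\to\mathbb{R}$ is the inclination angle of the arc-length parametrized planar curve $\gamma(s)=\gamma(0)+\int_0^s(\cos\theta,\sin\theta)\,\mathrm{d}r$, with curvature $\kappa=\partial_s\theta$; $\rho:[0,L]\to\mathbb{R}$ is a density. The flow (F) is the initial boundary value problem $$\partial_t\theta=\partial_s\big(\beta(\rho)(\partial_s\theta-c_0)\big)+\lambda_{\theta1}\sin\theta-\lambda_{\theta2}\cos\theta,\qquad \partial_t\rho=\mu\,\partial_s^2\rho-\tfrac12\beta'(\rho)(\partial_s\theta-c_0)^2-\lambda_\rho$$ on $(0,T)\times[0,L]$, with boundary conditions $\theta(\cdot,L)-\theta(\cdot,0)=2\pi\omega$, $\rho(\cdot,L)=\rho(\cdot,0)$, $\partial_s\theta(\cdot,L)=\partial_s\theta(\cdot,0)$,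 $\partial_s\rho(\cdot,L)=\partial_s\rho(\cdot,0)$, and initial condition $(\theta,\rho)(0,\cdot)=(\theta_0,\rho_0)$. The nonlocal multipliers are $$\begin{pmatrix}\lambda_{\theta1}\\ \lambda_{\theta2}\end{pmatrix}(t)=\Pi^{-1}(\theta)\int_0^L\begin{pmatrix}\cos\theta\\ \sin\theta\end{pmatrix}\partial_s\theta\,\beta(\rho)(\partial_s\theta-c_0)\,\mathrm{d}s,\quad \Pi(\theta)=\begin{pmatrix}\int_0^L\sin^2\theta\,\mathrm{d}s&-\int_0^L\cos\theta\sin\theta\,\mathrm{d}s\\-\int_0^L\cos\theta\sin\theta\,\mathrm{d}s&\int_0^L\cos^2\theta\,\mathrm{d}s\end{pmatrix},$$ $\lambda_\rho(t)=-\frac1{2L}\int_0^L\beta'(\rho)(\partial_s\theta-c_0)^2\,\mathrm{d}s$. An admissible initial datum is $(\theta_0,\rho_0)\in C^\infty([0,L])$ with $\int_0^L\rho_0\,\mathrm{d}s=\nu L$, $\int_0^L\sin\theta_0\,\mathrm{d}s=\int_0^L\cos\theta_0\,\mathrm{d}s=0$, $\theta_0(L)-\theta_0(0)=2\pi\omega$, $\rho_0(L)=\rho_0(0)$, and $\partial_s^j\theta_0(L)=\partial_s^j\theta_0(0)$, $\partial_s^j\rho_0(L)=\partial_s^j\rho_0(0)$ for $j=1,2$. By earlier work, for each admissible initial datum (F) has a unique global solution $(\theta,\rho)\in C^\infty((0,\infty)\times[0,L])\cap C^0([0,\infty);C^2([0,L]))$; for $t>0$ the functions $\partial_s\theta(t,\cdot)$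 and $\rho(t,\cdot)$ extend to smooth $L$-periodic functions on $\mathbb{R}$, and $\limsup_{t\to\infty}(\|\theta(t)\|_{W^{3,2}(0,L)}+\|\rho(t)\|_{W^{3,2}(0,L)})<\infty$. *)

theory Defs
  imports "HOL-Analysis.Analysis"
begin

(* Functions on [0,L] are represented by total functions real => real; only their values on {0..L}
   matter.  The derivative is taken within {0..L}, i.e. it is one-sided at the two end points. *)
definition sderiv :: "real \<Rightarrow> (real \<Rightarrow> real) \<Rightarrow> real \<Rightarrow> real" where
  "sderiv L f s = vector_derivative f (at s within {0..L})"

definition tderiv :: "(real \<Rightarrow> real \<Rightarrow> real) \<Rightarrow> real \<Rightarrow> real \<Rightarrow> real" where
  "tderiv u t s = deriv (\<lambda>\<tau>. u \<tau> s) t"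

abbreviation curvature :: "real \<Rightarrow> (real \<Rightarrow> real) \<Rightarrow> real \<Rightarrow> real" where
  "curvature L \<equiv> sderiv L"

definition smooth_real :: "(real \<Rightarrow> real) \<Rightarrow> bool" where
  "smooth_real f \<longleftrightarrow> (\<forall>k. (deriv ^^ k) f differentiable_on UNIV)"

definition smooth_interval :: "real \<Rightarrow> (real \<Rightarrow> real) \<Rightarrow> bool" where
  "smooth_interval L f \<longleftrightarrow> (\<forall>k. (sderiv L ^^ k) f differentiable_on {0..L})"

(* The class of infinitely differentiable functions on (0,infinity) x [0,L], up to the spatial
   boundary.  Differentiability is total (Frechet) differentiability within the strip, so every
   iterated partial derivative is in particular jointly continuous on it. *)
definition smooth_strip :: "real \<Rightarrow> (real \<Rightarrow> real \<Rightarrow> real) \<Rightarrow> bool" where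
  "smooth_strip L u \<longleftrightarrow>
     (\<forall>i j. (\<lambda>(t, s). (tderiv ^^ i) (\<lambda>\<tau>. (sderiv L ^^ j) (u \<tau>)) t s)
              differentiable_on ({0<..} \<times> {0..L}))"

definition C2_interval :: "real \<Rightarrow> (real \<Rightarrow> real) \<Rightarrow> bool" where
  "C2_interval L f \<longleftrightarrow>
     f differentiable_on {0..L} \<and> sderiv L f differentiable_on {0..L} \<and>
     continuous_on {0..L} (sderiv L (sderiv L f))"

(* C^0([0,infinity); C^2([0,L])): continuity in t with respect to the C^2 norm is uniform
   convergence of the s-derivatives of order 0, 1, 2. *)
definition C0_C2 :: "real \<Rightarrow> (real \<Rightarrow> real \<Rightarrow> real) \<Rightarrow> bool" where
  "C0_C2 L u \<longleftrightarrow>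
     (\<forall>t\<ge>0. C2_interval L (u t)) \<and>
     (\<forall>t\<ge>0. \<forall>j\<le>2. uniform_limit {0..L} (\<lambda>\<tau>. (sderiv L ^^ j) (u \<tau>)) ((sderiv L ^^ j) (u t))
                        (at t within {0..}))"

definition Pi_matrix :: "real \<Rightarrow> (real \<Rightarrow> real) \<Rightarrow> real ^ 2 ^ 2" where
  "Pi_matrix L \<theta> = vector
     [vector [integral {0..L} (\<lambda>s. (sin (\<theta> s))\<^sup>2), - integral {0..L} (\<lambda>s. cos (\<theta> s) * sin (\<theta> s))],
      vector [- integral {0..L} (\<lambda>s. cos (\<theta> s) * sin (\<theta> s)), integral {0..L} (\<lambda>s. (cos (\<theta> s))\<^sup>2)]]"

definition lambda_theta ::
    "real \<Rightarrow> real \<Rightarrow> (real \<Rightarrow> real) \<Rightarrow> (real \<Rightarrow> real) \<Rightarrow> (real \<Rightarrow> real) \<Rightarrow> real ^ 2" where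
  "lambda_theta L c0 \<beta> \<theta> \<rho> = matrix_inv (Pi_matrix L \<theta>) *v
     vector [integral {0..L} (\<lambda>s. cos (\<theta> s) * sderiv L \<theta> s * \<beta> (\<rho> s) * (sderiv L \<theta> s - c0)),
             integral {0..L} (\<lambda>s. sin (\<theta> s) * sderiv L \<theta> s * \<beta> (\<rho> s) * (sderiv L \<theta> s - c0))]"

definition lambda_rho ::
    "real \<Rightarrow> real \<Rightarrow> (real \<Rightarrow> real) \<Rightarrow> (real \<Rightarrow> real) \<Rightarrow> (real \<Rightarrow> real) \<Rightarrow> real" where
  "lambda_rho L c0 \<beta> \<theta> \<rho> =
     - 1 / (2 * L) * integral {0..L} (\<lambda>s. deriv \<beta> (\<rho> s) * (sderiv L \<theta> s - c0)\<^sup>2)"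

definition admissible_datum ::
    "real \<Rightarrow> real \<Rightarrow> int \<Rightarrow> (real \<Rightarrow> real) \<Rightarrow> (real \<Rightarrow> real) \<Rightarrow> bool" where
  "admissible_datum L \<nu> \<omega> \<theta>0 \<rho>0 \<longleftrightarrow>
     smooth_interval L \<theta>0 \<and> smooth_interval L \<rho>0 \<and>
     integral {0..L} \<rho>0 = \<nu> * L \<and>
     integral {0..L} (\<lambda>s. sin (\<theta>0 s)) = 0 \<and>
     integral {0..L} (\<lambda>s. cos (\<theta>0 s)) = 0 \<and>
     \<theta>0 L - \<theta>0 0 = 2 * pi * of_int \<omega> \<and>
     \<rho>0 L = \<rho>0 0 \<and>
     (\<forall>j\<in>{1, 2}. (sderiv L ^^ j) \<theta>0 L = (sderiv L ^^ j) \<theta>0 0 \<and>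
                  (sderiv L ^^ j) \<rho>0 L = (sderiv L ^^ j) \<rho>0 0)"

(* The invertibility clause only says that the inverse matrix occurring in lambda_theta makes
   sense (matrix_inv is a total function). *)
definition global_solution ::
    "real \<Rightarrow> real \<Rightarrow> int \<Rightarrow> real \<Rightarrow> (real \<Rightarrow> real) \<Rightarrow> (real \<Rightarrow> real) \<Rightarrow> (real \<Rightarrow> real) \<Rightarrow>
     (real \<Rightarrow> real \<Rightarrow> real) \<Rightarrow> (real \<Rightarrow> real \<Rightarrow> real) \<Rightarrow> bool" where
  "global_solution L \<mu> \<omega> c0 \<beta> \<theta>0 \<rho>0 \<theta> \<rho> \<longleftrightarrow>
     smooth_strip L \<theta> \<and> smooth_strip L \<rho> \<and> C0_C2 L \<theta> \<and> C0_C2 L \<rho> \<and>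
     (\<forall>t>0. invertible (Pi_matrix L (\<theta> t))) \<and>
     (\<forall>t>0. \<forall>s\<in>{0..L}.
        tderiv \<theta> t s =
          sderiv L (\<lambda>x. \<beta> (\<rho> t x) * (sderiv L (\<theta> t) x - c0)) s
          + lambda_theta L c0 \<beta> (\<theta> t) (\<rho> t) $ 1 * sin (\<theta> t s)
          - lambda_theta L c0 \<beta> (\<theta> t) (\<rho> t) $ 2 * cos (\<theta> t s)) \<and>
     (\<forall>t>0. \<forall>s\<in>{0..L}.
        tderiv \<rho> t s =
          \<mu> * sderiv L (sderiv L (\<rho> t)) s
          - 1 / 2 * deriv \<beta> (\<rho> t s) * (sderiv L (\<theta> t) s - c0)\<^sup>2
          - lambda_rho L c0 \<beta> (\<theta> t) (\<rho> t)) \<and>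
     (\<forall>t>0. \<theta> t L - \<theta> t 0 = 2 * pi * of_int \<omega> \<and>
            \<rho> t L = \<rho> t 0 \<and>
            sderiv L (\<theta> t) L = sderiv L (\<theta> t) 0 \<and>
            sderiv L (\<rho> t) L = sderiv L (\<rho> t) 0) \<and>
     (\<forall>s\<in>{0..L}. \<theta> 0 s = \<theta>0 s \<and> \<rho> 0 s = \<rho>0 s)"

end

(* For c0 = 0 the function u = beta(rho) kappa satisfies a linear parabolic equation in
   non-divergence form, u_t = beta(rho) u_ss + c u with
   c = beta'(rho) rho_t / beta(rho) + lambda_1 cos theta + lambda_2 sin theta.
   Substituting the evolution equation for rho_t, c extends continuously to t = 0, since the
   solution is C^0 in time with values in C^2 and the determinant of Pi stays away from 0: a closed
   curve is not a straight line.  Hence c is bounded on compact time intervals.  As u and u_s are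
   L-periodic, a minimum at an end point behaves like an interior one, and the maximum principle
   for exp(K t) u - a (a < 0 for the weak, a > 0 for the strict sign) gives the claim. *)
theory Submission
  imports Defs
begin

section \<open>Maximum principle for linear parabolic equations with periodic boundary
  values\<close>

lemma continuous_on_section_right:
  assumes "continuous_on (A \<times> B) (\<lambda>(t, s). f t s)" "t \<in> A"
  shows "continuous_on B (f t)"
proof -
  have "continuous_on B (\<lambda>s. (t, s))" by (intro continuous_intros)
  from continuous_on_compose2[OF assms(1) this] assms(2) show ?thesis by auto
qed

lemma continuous_on_section_left:
  assumes "continuous_on (A \<times> B) (\<lambda>(t, s). f t s)" "s \<in> B"
  shows "continuous_on A (\<lambda>t. f t s)"
proof -
  have "continuous_on A (\<lambda>t. (t, s))" by (intro continuous_intros)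
  from continuous_on_compose2[OF assms(1) this] assms(2) show ?thesis by auto
qed

text \<open>An interior minimum gives both inequalities for the derivative. An end point gives only
  one of them, but by periodicity the opposite end point is also a minimum with the same derivative
  and supplies the other.\<close>

lemma periodic_minimum_derivative_zero:
  fixes f :: "real \<Rightarrow> real"
  assumes "L > 0"
    and deriv: "\<And>x. x \<in> {0..L} \<Longrightarrow> (f has_real_derivative f' x) (at x within {0..L})"
    and per: "f L = f 0" "f' L = f' 0"
    and s: "s \<in> {0..L}" and min: "\<And>x. x \<in> {0..L} \<Longrightarrow> f s \<le> f x"
  shows "f' s = 0"
proof -
  \<comment> \<open>Stated for every point \<open>z\<close> that attains the minimal value, not just
    for \<open>s\<close>, so that both end points can be treated when \<open>s\<close> is one of
    them.\<close>
  have right: "f' z \<ge> 0" if z: "z \<in> {0..<L}" and fz: "f z = f s" for z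
  proof (rule ccontr)
    assume "\<not> f' z \<ge> 0"
    then obtain d where d: "d > 0" "\<And>h. h > 0 \<Longrightarrow> z + h \<in> {0..L} \<Longrightarrow> h < d \<Longrightarrow> f z > f (z + h)"
      using has_real_derivative_neg_dec_right[OF deriv[of z]] z by fastforce
    define h where "h = min (d / 2) (L - z)"
    have "h > 0" "h < d" "z + h \<in> {0..L}" using d(1) z by (auto simp: h_def)
    then show False using d(2)[of h] min[of "z + h"] fz by auto
  qed
  have left: "f' z \<le> 0" if z: "z \<in> {0<..L}" and fz: "f z = f s" for z
  proof (rule ccontr)
    assume "\<not> f' z \<le> 0"
    then obtain d where d: "d > 0" "\<And>h. h > 0 \<Longrightarrow> z - h \<in> {0..L} \<Longrightarrow> h < d \<Longrightarrow> f (z - h) < f z"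
      using has_real_derivative_pos_inc_left[OF deriv[of z]] z by fastforce
    define h where "h = min (d / 2) z"
    have "h > 0" "h < d" "z - h \<in> {0..L}" using d(1) z by (auto simp: h_def)
    then show False using d(2)[of h] min[of "z - h"] fz by auto
  qed
  consider "s = 0" | "s = L" | "0 < s" "s < L" using s by fastforce
  then show ?thesis
  proof cases
    case 1
    then show ?thesis using right[of 0] left[of L] per \<open>L > 0\<close> by auto
  next
    case 2
    then show ?thesis using right[of 0] left[of L] per \<open>L > 0\<close> by auto
  next
    case 3
    then show ?thesis using right[of s] left[of s] by auto
  qed
qed

text \<open>As \<open>f' s = 0\<close> even at an end point, one side of \<open>s\<close> suffices:
  with \<open>d < 0\<close>, \<open>f'\<close> is negative just to the right of \<open>s\<close> and
  positive just to the left, so by the mean value theorem \<open>f\<close> falls below its minimum.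
  The right side is used unless \<open>s = L\<close>.\<close>

lemma periodic_minimum_second_derivative:
  fixes f :: "real \<Rightarrow> real"
  assumes "L > 0"
    and deriv: "\<And>x. x \<in> {0..L} \<Longrightarrow> (f has_real_derivative f' x) (at x within {0..L})"
    and deriv2: "(f' has_real_derivative d) (at s within {0..L})"
    and per: "f L = f 0" "f' L = f' 0"
    and s: "s \<in> {0..L}" and min: "\<And>x. x \<in> {0..L} \<Longrightarrow> f s \<le> f x"
  shows "d \<ge> 0"
proof (rule ccontr)
  assume "\<not> d \<ge> 0"
  then have d: "d < 0" by simp
  have zero: "f' s = 0"
    using periodic_minimum_derivative_zero[OF \<open>L > 0\<close> deriv per s min] by blast
  have mvt: "\<exists>z\<in>{a<..<b}. f b - f a = f' z * (b - a)" if "a < b" "{a..b} \<subseteq> {0..L}" for a b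
  proof (rule mvt_simple[OF \<open>a < b\<close>, of f "\<lambda>z. (*) (f' z)"])
    fix x assume "a \<le> x" "x \<le> b"
    then have "x \<in> {0..L}" using that by auto
    then show "(f has_derivative (*) (f' x)) (at x within {a..b})"
      using DERIV_subset[OF deriv that(2)] by (simp add: has_field_derivative_def)
  qed
  show False
  proof (cases "s < L")
    case True
    obtain e where e: "e > 0" "\<And>h. h > 0 \<Longrightarrow> s + h \<in> {0..L} \<Longrightarrow> h < e \<Longrightarrow> f' s > f' (s + h)"
      using has_real_derivative_neg_dec_right[OF deriv2 d] by blast
    define b where "b = min (s + e / 2) L"
    have b: "s < b" "{s..b} \<subseteq> {0..L}" "b < s + e" using e(1) True s by (auto simp: b_def)
    then obtain z where z: "z \<in> {s<..<b}" "f b - f s = f' z * (b - s)" using mvt by blast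
    have "f' z < 0" using e(2)[of "z - s"] z(1) b zero by (auto simp: subset_eq)
    then have "f b < f s" using z b by (smt (verit) mult_neg_pos)
    then show False using min[of b] b by (auto simp: subset_eq)
  next
    case False
    then have "s = L" using s by simp
    obtain e where e: "e > 0" "\<And>h. h > 0 \<Longrightarrow> s - h \<in> {0..L} \<Longrightarrow> h < e \<Longrightarrow> f' s < f' (s - h)"
      using has_real_derivative_neg_dec_left[OF deriv2 d] by blast
    define a where "a = max (s - e / 2) 0"
    have a: "a < s" "{a..s} \<subseteq> {0..L}" "s - e < a" using e(1) \<open>s = L\<close> \<open>L > 0\<close> by (auto simp: a_def)
    then obtain z where z: "z \<in> {a<..<s}" "f s - f a = f' z * (s - a)" using mvt by blast
    have "f' z > 0" using e(2)[of "s - z"] z(1) a zero by (auto simp: subset_eq)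
    then have "f a < f s" using z a by (smt (verit) mult_pos_pos)
    then show False using min[of a] a by (auto simp: subset_eq)
  qed
qed

text \<open>At the first time at which positivity fails, \<open>v\<close> is still nonnegative on
  all of \<open>S\<close> and vanishes somewhere. An increase in time at that zero would mean
  negative values shortly before, against the choice of the time.\<close>

lemma positive_if_increasing_at_first_zero:
  fixes v :: "real \<Rightarrow> real \<Rightarrow> real"
  assumes "compact S"
    and cont: "continuous_on ({0..T} \<times> S) (\<lambda>(t, s). v t s)"
    and init: "\<And>s. s \<in> S \<Longrightarrow> v 0 s > 0"
    and touch: "\<And>t s. t \<in> {0<..T} \<Longrightarrow> s \<in> S \<Longrightarrow> v t s = 0 \<Longrightarrow> (\<And>x. x \<in> S \<Longrightarrow> 0 \<le> v t x) \<Longrightarrow>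
           \<exists>d>0. ((\<lambda>\<tau>. v \<tau> s) has_real_derivative d) (at t)"
    and ts: "t \<in> {0..T}" "s \<in> S"
  shows "v t s > 0"
proof (rule ccontr)
  assume neg: "\<not> v t s > 0"
  \<comment> \<open>The set of failures is compact, so an earliest failure exists.\<close>
  define Z where "Z = ({0..T} \<times> S) \<inter> (\<lambda>(t, s). v t s) -` {..0}"
  have "compact ({0..T} \<times> S)" using \<open>compact S\<close> by (intro compact_Times) auto
  then have "compact Z"
    unfolding Z_def
    by (rule closedin_compact) (rule continuous_closedin_preimage[OF cont closed_atMost])
  moreover have "(t, s) \<in> Z" using neg ts by (auto simp: Z_def)
  ultimately have "\<exists>p\<in>Z. \<forall>q\<in>Z. fst p \<le> fst q"
    by (intro continuous_attains_inf) (auto intro!: continuous_intros)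
  then obtain p where p: "p \<in> Z" "\<And>q. q \<in> Z \<Longrightarrow> fst p \<le> fst q" by blast
  obtain t0 s0 where p0: "p = (t0, s0)" by force
  have t0: "t0 \<in> {0..T}" and s0: "s0 \<in> S" and v0: "v t0 s0 \<le> 0" using p(1) by (auto simp: Z_def p0)
  have before: "v \<tau> x > 0" if "0 \<le> \<tau>" "\<tau> < t0" "x \<in> S" for \<tau> x
    using p(2)[of "(\<tau>, x)"] that t0 by (force simp: Z_def p0)
  have "t0 > 0" using init[OF s0] v0 t0 by (cases "t0 = 0") auto
  \<comment> \<open>Each \<open>v t0 x\<close> is a left limit in time of positive values; this
    makes the failure at \<open>s0\<close> an exact zero.\<close>
  have nonneg: "v t0 x \<ge> 0" if x: "x \<in> S" for x
  proof -
    have "continuous_on {0..T} (\<lambda>\<tau>. v \<tau> x)"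
      by (rule continuous_on_section_left[OF cont x])
    then have "continuous_on {0..t0} (\<lambda>\<tau>. v \<tau> x)"
      by (rule continuous_on_subset) (use t0 in auto)
    then have "((\<lambda>\<tau>. v \<tau> x) \<longlongrightarrow> v t0 x) (at t0 within {0..t0})"
      using \<open>t0 > 0\<close> by (simp add: continuous_on)
    then have "((\<lambda>\<tau>. v \<tau> x) \<longlongrightarrow> v t0 x) (at_left t0)"
      using \<open>t0 > 0\<close> by (simp add: at_within_Icc_at_left)
    moreover have "\<forall>\<^sub>F \<tau> in at_left t0. 0 \<le> v \<tau> x"
      using eventually_at_left_real[OF \<open>t0 > 0\<close>]
      by eventually_elim (use before x in \<open>auto intro: less_imp_le\<close>)
    ultimately show ?thesis by (rule tendsto_lowerbound) simp
  qed
  then have "v t0 s0 = 0" using v0 s0 by force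
  then obtain d where "d > 0" "((\<lambda>\<tau>. v \<tau> s0) has_real_derivative d) (at t0)"
    using touch[of t0 s0] t0 s0 \<open>t0 > 0\<close> nonneg by auto
  then obtain e where e: "e > 0" "\<And>h. h > 0 \<Longrightarrow> h < e \<Longrightarrow> v (t0 - h) s0 < v t0 s0"
    using DERIV_pos_inc_left by blast
  \<comment> \<open>The bound by \<open>t0\<close> keeps \<open>t0 - h\<close> in the time range
    where positivity is already known.\<close>
  define h where "h = min (e / 2) t0"
  have "h > 0" "h < e" "h \<le> t0" using e(1) \<open>t0 > 0\<close> by (auto simp: h_def)
  then show False using e(2)[of h] before[of "t0 - h" s0] v0 s0 by auto
qed

text \<open>The function \<open>w = exp (K * t) * u - a\<close> satisfies
  \<open>w_t = b * w_ss + (c + K) * (w + a)\<close>. At a first zero, which is a spatial minimum,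
  the diffusion term is nonnegative and the rest equals \<open>(c + K) * a > 0\<close>, so
  \<open>w\<close> increases there. Requiring only the sign of this product admits levels
  \<open>a\<close> of either sign.\<close>

lemma periodic_linear_parabolic_barrier:
  fixes u :: "real \<Rightarrow> real \<Rightarrow> real"
  assumes "L > 0"
    and cont: "continuous_on ({0..T} \<times> {0..L}) (\<lambda>(t, s). u t s)"
    and ux: "\<And>t s. t \<in> {0<..T} \<Longrightarrow> s \<in> {0..L} \<Longrightarrow> (u t has_real_derivative ux t s) (at s within {0..L})"
    and uxx: "\<And>t s. t \<in> {0<..T} \<Longrightarrow> s \<in> {0..L} \<Longrightarrow> (ux t has_real_derivative uxx t s) (at s within {0..L})"
    and ut: "\<And>t s. t \<in> {0<..T} \<Longrightarrow> s \<in> {0..L} \<Longrightarrow>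
               ((\<lambda>\<tau>. u \<tau> s) has_real_derivative b t s * uxx t s + c t s * u t s) (at t)"
    and per: "\<And>t. t \<in> {0<..T} \<Longrightarrow> u t L = u t 0" "\<And>t. t \<in> {0<..T} \<Longrightarrow> ux t L = ux t 0"
    and b: "\<And>t s. t \<in> {0<..T} \<Longrightarrow> s \<in> {0..L} \<Longrightarrow> b t s \<ge> 0"
    and K: "\<And>t s. t \<in> {0<..T} \<Longrightarrow> s \<in> {0..L} \<Longrightarrow> (c t s + K) * a > 0"
    and init: "\<And>s. s \<in> {0..L} \<Longrightarrow> u 0 s > a"
    and ts: "t \<in> {0..T}" "s \<in> {0..L}"
  shows "exp (K * t) * u t s > a"
proof -
  have "exp (K * t) * u t s - a > 0"
  proof (rule positive_if_increasing_at_first_zero[OF compact_Icc _ _ _ ts])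
    show "continuous_on ({0..T} \<times> {0..L}) (\<lambda>(t, s). exp (K * t) * u t s - a)"
      using cont by (auto intro!: continuous_intros simp: split_beta)
    show "exp (K * 0) * u 0 x - a > 0" if "x \<in> {0..L}" for x using init[OF that] by simp
  next
    fix t s assume t: "t \<in> {0<..T}" and s: "s \<in> {0..L}"
      and zero: "exp (K * t) * u t s - a = 0"
      and nonneg: "\<And>x. x \<in> {0..L} \<Longrightarrow> 0 \<le> exp (K * t) * u t x - a"
    have min: "u t s \<le> u t x" if "x \<in> {0..L}" for x
      using nonneg[OF that] zero by (smt (verit) exp_gt_zero mult_left_less_imp_less mult_less_cancel_left_pos)
    have "uxx t s \<ge> 0"
      by (rule periodic_minimum_second_derivative[OF \<open>L > 0\<close> ux[OF t] uxx[OF t s] per[OF t] s min])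
    then have "exp (K * t) * (b t s * uxx t s) \<ge> 0" using b[OF t s] by simp
    moreover have "(c t s + K) * (exp (K * t) * u t s) > 0" using K[OF t s] zero by simp
    ultimately have "exp (K * t) * (b t s * uxx t s + c t s * u t s) + exp (K * t) * K * u t s > 0"
      by (simp add: algebra_simps)
    moreover have "((\<lambda>\<tau>. exp (K * \<tau>) * u \<tau> s - a) has_real_derivative
        exp (K * t) * (b t s * uxx t s + c t s * u t s) + exp (K * t) * K * u t s) (at t)"
      by (auto intro!: derivative_eq_intros ut[OF t s])
    ultimately show "\<exists>d>0. ((\<lambda>\<tau>. exp (K * \<tau>) * u \<tau> s - a) has_real_derivative d) (at t)" by blast
  qed
  then show ?thesis by simp
qed

text \<open>No sign of \<open>c\<close> is available, only a bound; the exponential factor of the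
  barrier, with rate \<open>M + 1\<close> of suitable sign, absorbs it.\<close>

lemma periodic_linear_parabolic_sign:
  fixes u :: "real \<Rightarrow> real \<Rightarrow> real"
  assumes "L > 0"
    and cont: "continuous_on ({0..T} \<times> {0..L}) (\<lambda>(t, s). u t s)"
    and ux: "\<And>t s. t \<in> {0<..T} \<Longrightarrow> s \<in> {0..L} \<Longrightarrow> (u t has_real_derivative ux t s) (at s within {0..L})"
    and uxx: "\<And>t s. t \<in> {0<..T} \<Longrightarrow> s \<in> {0..L} \<Longrightarrow> (ux t has_real_derivative uxx t s) (at s within {0..L})"
    and ut: "\<And>t s. t \<in> {0<..T} \<Longrightarrow> s \<in> {0..L} \<Longrightarrow>
               ((\<lambda>\<tau>. u \<tau> s) has_real_derivative b t s * uxx t s + c t s * u t s) (at t)"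
    and per: "\<And>t. t \<in> {0<..T} \<Longrightarrow> u t L = u t 0" "\<And>t. t \<in> {0<..T} \<Longrightarrow> ux t L = ux t 0"
    and b: "\<And>t s. t \<in> {0<..T} \<Longrightarrow> s \<in> {0..L} \<Longrightarrow> b t s \<ge> 0"
    and c: "\<And>t s. t \<in> {0<..T} \<Longrightarrow> s \<in> {0..L} \<Longrightarrow> \<bar>c t s\<bar> \<le> M"
    and ts: "t \<in> {0..T}" "s \<in> {0..L}"
  shows "(\<And>x. x \<in> {0..L} \<Longrightarrow> u 0 x \<ge> 0) \<Longrightarrow> u t s \<ge> 0"
    and "(\<And>x. x \<in> {0..L} \<Longrightarrow> u 0 x > 0) \<Longrightarrow> u t s > 0"
proof -
  note barrier = periodic_linear_parabolic_barrier[OF \<open>L > 0\<close> cont ux uxx ut per b _ _ ts]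
  {
    assume init: "\<And>x. x \<in> {0..L} \<Longrightarrow> u 0 x \<ge> 0"
    \<comment> \<open>The levels \<open>- e\<close> lie strictly below the nonnegative initial
      values. For \<open>K = - (M + 1)\<close> both \<open>c + K\<close> and the level are negative,
      hence their product is positive; then \<open>e\<close> tends to 0.\<close>
    have "exp (- (M + 1) * t) * u t s \<ge> 0"
    proof (rule field_le_epsilon)
      fix e :: real assume e: "e > 0"
      have "(c t s + - (M + 1)) * - e > 0" if "t \<in> {0<..T}" "s \<in> {0..L}" for t s
        using c[OF that] e by (intro mult_neg_neg) auto
      then have "exp (- (M + 1) * t) * u t s > - e"
        using barrier[of "- (M + 1)" "- e"] init e by force
      then show "0 \<le> exp (- (M + 1) * t) * u t s + e" by simp
    qed
    then show "u t s \<ge> 0" by (simp add: zero_le_mult_iff)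
  }
  {
    assume init: "\<And>x. x \<in> {0..L} \<Longrightarrow> u 0 x > 0"
    have "continuous_on {0..L} (u 0)"
      by (rule continuous_on_section_right[OF cont]) (use ts in auto)
    then obtain z where z: "z \<in> {0..L}" "\<And>x. x \<in> {0..L} \<Longrightarrow> u 0 z \<le> u 0 x"
      using continuous_attains_inf[of "{0..L}" "u 0"] \<open>L > 0\<close> by auto
    \<comment> \<open>Half of the attained initial minimum is positive and leaves the strict gap
      that the barrier needs; now \<open>c + (M + 1) \<ge> 1\<close>.\<close>
    define a where "a = u 0 z / 2"
    have a: "a > 0" "\<And>x. x \<in> {0..L} \<Longrightarrow> u 0 x > a"
      using init[OF z(1)] z(2) by (force simp: a_def)+
    have "(c t s + (M + 1)) * a > 0" if "t \<in> {0<..T}" "s \<in> {0..L}" for t s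
      using c[OF that] a by (intro mult_pos_pos) auto
    then have "exp ((M + 1) * t) * u t s > a" using barrier[of "M + 1" a] a by blast
    then have "exp ((M + 1) * t) * u t s > 0" using a by linarith
    then show "u t s > 0" by (simp add: zero_less_mult_iff)
  }
qed

section \<open>Calculus on the space-time strip\<close>

text \<open>Composing with the embedding of a time slice turns the Frechet differentiability from
  \<open>smooth_strip\<close> into a spatial derivative, one-sided at the ends.\<close>

lemma differentiable_on_strip_sderiv:
  assumes "(\<lambda>(t, s). g t s) differentiable_on {0<..} \<times> {0..L}" "t > 0" "s \<in> {0..L}"
  shows "(g t has_real_derivative sderiv L (g t) s) (at s within {0..L})"
proof -
  have "(\<lambda>(t, s). g t s) differentiable (at (t, s) within Pair t ` {0..L})"
    by (rule differentiable_within_subset[of _ "(t, s)" "{0<..} \<times> {0..L}"])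
      (use assms in \<open>auto simp: differentiable_on_def\<close>)
  moreover have "Pair t differentiable (at s within {0..L})"
    by (auto intro!: differentiableI derivative_eq_intros)
  ultimately have "(\<lambda>(t, s). g t s) \<circ> Pair t differentiable (at s within {0..L})"
    by (intro differentiable_chain_within)
  then show ?thesis
    by (simp add: o_def sderiv_def vector_derivative_works has_real_derivative_iff_has_vector_derivative)
qed

lemma differentiable_on_strip_tderiv:
  assumes "(\<lambda>(t, s). g t s) differentiable_on {0<..} \<times> {0..L}" "t > 0" "s \<in> {0..L}"
  shows "((\<lambda>\<tau>. g \<tau> s) has_real_derivative tderiv g t s) (at t)"
proof -
  have "(\<lambda>(t, s). g t s) differentiable (at (t, s) within (\<lambda>\<tau>. (\<tau>, s)) ` {0<..})"
    by (rule differentiable_within_subset[of _ "(t, s)" "{0<..} \<times> {0..L}"])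
      (use assms in \<open>auto simp: differentiable_on_def\<close>)
  moreover have "(\<lambda>\<tau>. (\<tau>, s)) differentiable (at t within {0<..})"
    by (auto intro!: differentiableI derivative_eq_intros)
  ultimately have "(\<lambda>(t, s). g t s) \<circ> (\<lambda>\<tau>. (\<tau>, s)) differentiable (at t within {0<..})"
    by (intro differentiable_chain_within)
  \<comment> \<open>As \<open>{0<..}\<close> is open, the derivative within it is the two-sided one
    used by \<open>tderiv\<close>.\<close>
  then have "(\<lambda>\<tau>. g \<tau> s) differentiable (at t)"
    using \<open>t > 0\<close> by (simp add: o_def at_within_open[of t "{0<..}"])
  then show ?thesis
    unfolding tderiv_def
    using DERIV_deriv_iff_real_differentiable by blast
qed

text \<open>Uniform convergence in \<open>s\<close> and continuity in \<open>s\<close> at the limit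
  time combine through the intermediate value \<open>?f t x\<close>. This gives joint continuity
  down to time 0, about which \<open>smooth_strip\<close> says nothing.\<close>

lemma C0_C2_continuous_on:
  assumes "C0_C2 L u" "j \<le> 2"
  shows "continuous_on ({0..} \<times> {0..L}) (\<lambda>(t, s). (sderiv L ^^ j) (u t) s)"
proof -
  let ?f = "\<lambda>t. (sderiv L ^^ j) (u t)"
  have cont: "continuous_on {0..L} (?f t)" if "t \<ge> 0" for t
  proof -
    have C2: "C2_interval L (u t)" using assms(1) that by (simp add: C0_C2_def)
    consider "j = 0" | "j = 1" | "j = 2" using assms(2) by linarith
    then show ?thesis
      by cases (use C2 in \<open>auto simp: C2_interval_def numeral_2_eq_2 intro: differentiable_imp_continuous_on\<close>)
  qed
  show ?thesis
    unfolding continuous_on_iff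
  proof (intro ballI allI impI)
    fix p :: "real \<times> real" and e :: real assume p: "p \<in> {0..} \<times> {0..L}" and "e > 0"
    obtain t s where ts: "p = (t, s)" "t \<ge> 0" "s \<in> {0..L}" using p by force
    have "\<forall>\<^sub>F \<tau> in at t within {0..}. \<forall>x\<in>{0..L}. dist (?f \<tau> x) (?f t x) < e / 2"
    proof -
      have "uniform_limit {0..L} ?f (?f t) (at t within {0..})"
        using assms ts(2) by (simp add: C0_C2_def)
      then show ?thesis by (rule uniform_limitD) (use \<open>e > 0\<close> in simp)
    qed
    then obtain d1 where d1: "d1 > 0"
      "\<And>\<tau> x. \<tau> \<ge> 0 \<Longrightarrow> \<tau> \<noteq> t \<Longrightarrow> dist \<tau> t < d1 \<Longrightarrow> x \<in> {0..L} \<Longrightarrow> dist (?f \<tau> x) (?f t x) < e / 2"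
      unfolding eventually_at by (metis atLeast_iff)
    have d1': "dist (?f \<tau> x) (?f t x) < e / 2" if "\<tau> \<ge> 0" "dist \<tau> t < d1" "x \<in> {0..L}" for \<tau> x
      using d1(2)[OF that(1) _ that(2,3)] \<open>e > 0\<close> by (cases "\<tau> = t") auto
    obtain d2 where d2: "d2 > 0" "\<And>x. x \<in> {0..L} \<Longrightarrow> dist x s < d2 \<Longrightarrow> dist (?f t x) (?f t s) < e / 2"
      using cont[OF ts(2)] ts(3) \<open>e > 0\<close> unfolding continuous_on_iff by (metis half_gt_zero)
    show "\<exists>d>0. \<forall>q\<in>{0..} \<times> {0..L}. dist q p < d \<longrightarrow>
        dist (case q of (t, s) \<Rightarrow> ?f t s) (case p of (t, s) \<Rightarrow> ?f t s) < e"
    proof (intro exI[of _ "min d1 d2"] conjI ballI impI)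
      fix q :: "real \<times> real" assume q: "q \<in> {0..} \<times> {0..L}" "dist q p < min d1 d2"
      obtain \<tau> x where \<tau>: "q = (\<tau>, x)" "\<tau> \<ge> 0" "x \<in> {0..L}" using q by force
      have "dist \<tau> t < d1" "dist x s < d2"
        using q(2) dist_fst_le[of q p] dist_snd_le[of q p] by (auto simp: \<tau> ts)
      then have "dist (?f \<tau> x) (?f t x) < e / 2" "dist (?f t x) (?f t s) < e / 2"
        using d1' d2 \<tau> by auto
      then show "dist (case q of (t, s) \<Rightarrow> ?f t s) (case p of (t, s) \<Rightarrow> ?f t s) < e"
        using dist_triangle_less_add[of "?f \<tau> x" "?f t x" "e / 2" "?f t s" "e / 2"]
        by (simp add: \<tau> ts dist_commute)
    qed (use d1 d2 in auto)
  qed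
qed

text \<open>Exchange of the two derivatives: \<open>u\<close> minus its value at 0 is the spatial
  integral of \<open>sderiv L (u t)\<close>; differentiate under the integral in time, then by the
  upper limit in space.\<close>

lemma smooth_strip_mixed_derivative:
  assumes "L > 0" and smooth: "smooth_strip L u" and "t > 0" and s: "s \<in> {0..L}"
  shows "(tderiv u t has_real_derivative tderiv (\<lambda>\<tau>. sderiv L (u \<tau>)) t s) (at s within {0..L})"
proof -
  let ?k = "\<lambda>t. sderiv L (u t)"
  have diff: "(\<lambda>(t, s). (tderiv ^^ i) (\<lambda>\<tau>. (sderiv L ^^ j) (u \<tau>)) t s) differentiable_on {0<..} \<times> {0..L}" for i j
    using smooth by (simp add: smooth_strip_def)
  have u: "(\<lambda>(t, s). u t s) differentiable_on {0<..} \<times> {0..L}" using diff[of 0 0] by simp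
  have k: "(\<lambda>(t, s). ?k t s) differentiable_on {0<..} \<times> {0..L}" using diff[of 0 1] by simp
  have kt: "continuous_on ({0<..} \<times> {0..L}) (\<lambda>(t, s). tderiv ?k t s)"
    using diff[of 1 1] by (auto intro: differentiable_imp_continuous_on)
  have k_cont: "continuous_on {0..L} (?k \<tau>)" if "\<tau> > 0" for \<tau>
    using differentiable_on_strip_sderiv[OF k that] by (meson DERIV_continuous_on)
  have kt_cont: "continuous_on {0..L} (tderiv ?k t)"
    by (rule continuous_on_section_right[OF kt]) (use \<open>t > 0\<close> in auto)
  have ftc: "integral {0..x} (?k \<tau>) = u \<tau> x - u \<tau> 0" if "\<tau> > 0" "x \<in> {0..L}" for \<tau> x
  proof (rule integral_unique, rule fundamental_theorem_of_calculus)
    fix y assume "y \<in> {0..x}"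
    then show "(u \<tau> has_vector_derivative ?k \<tau> y) (at y within {0..x})"
      using differentiable_on_strip_sderiv[OF u \<open>\<tau> > 0\<close>, of y] that
      by (auto simp: has_real_derivative_iff_has_vector_derivative intro: has_vector_derivative_within_subset)
  qed (use that in auto)
  \<comment> \<open>Two computations of the time derivative of
    \<open>integral {0..x} (?k \<tau>)\<close> are compared: by the Leibniz rule and through
    \<open>ftc\<close>.\<close>
  have eq: "integral {0..x} (tderiv ?k t) + tderiv u t 0 = tderiv u t x" if x: "x \<in> {0..L}" for x
  proof -
    have "((\<lambda>\<tau>. integral (cbox 0 x) (?k \<tau>)) has_real_derivative integral (cbox 0 x) (tderiv ?k t)) (at t within {0<..})"
    proof (rule leibniz_rule_field_derivative)
      show "((\<lambda>\<tau>. ?k \<tau> y) has_real_derivative tderiv ?k \<tau> y) (at \<tau> within {0<..})"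
        if "\<tau> \<in> {0<..}" "y \<in> cbox 0 x" for \<tau> y
        using differentiable_on_strip_tderiv[OF k, of \<tau> y] that x by (auto intro: DERIV_subset)
      show "?k \<tau> integrable_on cbox 0 x" if "\<tau> \<in> {0<..}" for \<tau>
        by (rule integrable_continuous, rule continuous_on_subset[OF k_cont]) (use that x in auto)
      show "continuous_on ({0<..} \<times> cbox 0 x) (\<lambda>(\<tau>, y). tderiv ?k \<tau> y)"
        using kt by (rule continuous_on_subset) (use x in auto)
    qed (use \<open>t > 0\<close> in auto)
    then have "((\<lambda>\<tau>. integral {0..x} (?k \<tau>)) has_real_derivative integral {0..x} (tderiv ?k t)) (at t)"
      using \<open>t > 0\<close> by (simp add: at_within_open[of t "{0<..}"])
    moreover have "((\<lambda>\<tau>. integral {0..x} (?k \<tau>)) has_real_derivative tderiv u t x - tderiv u t 0) (at t)"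
    proof (rule has_field_derivative_transform_within_open[of "\<lambda>\<tau>. u \<tau> x - u \<tau> 0" _ _ "{0<..}"])
      show "((\<lambda>\<tau>. u \<tau> x - u \<tau> 0) has_real_derivative tderiv u t x - tderiv u t 0) (at t)"
        using \<open>L > 0\<close> x by (intro DERIV_diff differentiable_on_strip_tderiv[OF u \<open>t > 0\<close>]) auto
    qed (use \<open>t > 0\<close> ftc[OF _ x] in auto)
    ultimately show ?thesis using DERIV_unique by fastforce
  qed
  have "((\<lambda>x. integral {0..x} (tderiv ?k t) + tderiv u t 0) has_real_derivative tderiv ?k t s) (at s within {0..L})"
    using DERIV_add[OF integral_has_real_derivative[OF kt_cont s] DERIV_const] by simp
  then show ?thesis
    using eq s has_field_derivative_transform_within[of _ _ s "{0..L}" 1] by (smt (verit) zero_less_one)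
qed

section \<open>The nonlocal multipliers\<close>

text \<open>\<open>Pi_matrix\<close> is the Gram matrix of \<open>sin \<theta>\<close> and
  \<open>- cos \<theta>\<close>. If it were singular, the tangent would be parallel to a fixed
  vector \<open>(a, b)\<close>; by continuity it could not reverse, so the curve would be a straight
  segment and not close up.\<close>

lemma Pi_matrix_det_nonzero_of_closed:
  assumes "L > 0" and cont: "continuous_on {0..L} \<theta>"
    and closed: "integral {0..L} (\<lambda>s. sin (\<theta> s)) = 0" "integral {0..L} (\<lambda>s. cos (\<theta> s)) = 0"
  shows "det (Pi_matrix L \<theta>) \<noteq> 0"
proof
  define A where "A = integral {0..L} (\<lambda>s. (sin (\<theta> s))\<^sup>2)"
  define B where "B = integral {0..L} (\<lambda>s. (cos (\<theta> s))\<^sup>2)"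
  define C where "C = integral {0..L} (\<lambda>s. cos (\<theta> s) * sin (\<theta> s))"
  note [continuous_intros] = cont
  assume "det (Pi_matrix L \<theta>) = 0"
  then have AB: "A * B = C * C"
    by (simp add: det_2 Pi_matrix_def A_def B_def C_def)
  have "A + B = integral {0..L} (\<lambda>s. (sin (\<theta> s))\<^sup>2 + (cos (\<theta> s))\<^sup>2)"
    unfolding A_def B_def
    by (rule Henstock_Kurzweil_Integration.integral_add[symmetric])
      (auto intro!: integrable_continuous_interval continuous_intros)
  also have "\<dots> = L" using \<open>L > 0\<close> by simp
  finally have "A + B = L" .
  \<comment> \<open>A null vector of the quadratic form of the matrix: \<open>(B, C)\<close> is
    orthogonal to the second row \<open>(- C, B)\<close>, and \<open>(0, 1)\<close> serves when
    \<open>B = 0\<close>. The form is the integral of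
    \<open>(a * sin \<theta> - b * cos \<theta>)\<close> squared.\<close>
  have "\<exists>a b. (a \<noteq> 0 \<or> b \<noteq> 0) \<and> a\<^sup>2 * A - 2 * a * b * C + b\<^sup>2 * B = 0"
  proof (cases "B = 0")
    case True
    then show ?thesis using AB by (intro exI[of _ 0] exI[of _ 1]) auto
  next
    case False
    have "B\<^sup>2 * A - 2 * B * C * C + C\<^sup>2 * B = B * (A * B - C * C)" by algebra
    then show ?thesis using AB False by (intro exI[of _ B] exI[of _ C]) auto
  qed
  then obtain a b :: real where ab: "a \<noteq> 0 \<or> b \<noteq> 0" "a\<^sup>2 * A - 2 * a * b * C + b\<^sup>2 * B = 0" by blast
  have i: "(\<lambda>s. (sin (\<theta> s))\<^sup>2) integrable_on {0..L}" "(\<lambda>s. (cos (\<theta> s))\<^sup>2) integrable_on {0..L}"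
    "(\<lambda>s. cos (\<theta> s) * sin (\<theta> s)) integrable_on {0..L}"
    "(\<lambda>s. cos (\<theta> s)) integrable_on {0..L}" "(\<lambda>s. sin (\<theta> s)) integrable_on {0..L}"
    by (auto intro!: integrable_continuous_interval continuous_intros)
  have "((\<lambda>s. a\<^sup>2 * (sin (\<theta> s))\<^sup>2 - 2 * a * b * (cos (\<theta> s) * sin (\<theta> s)) + b\<^sup>2 * (cos (\<theta> s))\<^sup>2)
      has_integral a\<^sup>2 * A - 2 * a * b * C + b\<^sup>2 * B) {0..L}"
    unfolding A_def B_def C_def
    by (intro has_integral_add has_integral_diff has_integral_mult_right integrable_integral i)
  then have "((\<lambda>s. (a * sin (\<theta> s) - b * cos (\<theta> s))\<^sup>2) has_integral 0) {0..L}"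
    using ab(2) by (simp add: power2_diff power_mult_distrib algebra_simps)
  then have zero: "a * sin (\<theta> s) - b * cos (\<theta> s) = 0" if "s \<in> {0..L}" for s
  proof -
    have "continuous_on {0..L} (\<lambda>s. (a * sin (\<theta> s) - b * cos (\<theta> s))\<^sup>2)"
      by (intro continuous_intros)
    then show ?thesis
      using has_integral_0_cbox_imp_0[of 0 L "\<lambda>s. (a * sin (\<theta> s) - b * cos (\<theta> s))\<^sup>2" s] \<open>L > 0\<close> that
        \<open>(_ has_integral 0) _\<close> by simp
  qed
  \<comment> \<open>\<open>g\<close> is the inner product of the tangent with \<open>(a, b)\<close>.
    The perpendicular component vanishes, so \<open>g\<close> has constant nonzero modulus.\<close>
  define g where "g s = a * cos (\<theta> s) + b * sin (\<theta> s)" for s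
  have g: "(g s)\<^sup>2 = a\<^sup>2 + b\<^sup>2" if "s \<in> {0..L}" for s
  proof -
    have "(g s)\<^sup>2 + (a * sin (\<theta> s) - b * cos (\<theta> s))\<^sup>2 = (a\<^sup>2 + b\<^sup>2) * ((sin (\<theta> s))\<^sup>2 + (cos (\<theta> s))\<^sup>2)"
      unfolding g_def by algebra
    then show ?thesis using zero[OF that] by simp
  qed
  have g_cont: "continuous_on {0..L} g" unfolding g_def by (intro continuous_intros)
  have "(g has_integral a * integral {0..L} (\<lambda>s. cos (\<theta> s)) + b * integral {0..L} (\<lambda>s. sin (\<theta> s))) {0..L}"
    unfolding g_def
    by (intro has_integral_add has_integral_mult_right integrable_integral i)
  then have g_int: "(g has_integral 0) {0..L}" by (simp add: closed)
  have "a\<^sup>2 + b\<^sup>2 > 0" using ab(1) by (simp add: sum_power2_gt_zero_iff)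
  then have g_ne: "g s \<noteq> 0" if "s \<in> {0..L}" for s using g[OF that] by auto
  \<comment> \<open>A continuous function without zeros keeps its sign on an interval, and then a
    vanishing integral forces it to be zero.\<close>
  have "(\<forall>s\<in>{0..L}. g s \<ge> 0) \<or> (\<forall>s\<in>{0..L}. g s \<le> 0)"
  proof (rule ccontr)
    assume "\<not> ?thesis"
    then obtain x y where xy: "x \<in> {0..L}" "y \<in> {0..L}" "g x < 0" "0 < g y" by force
    have "connected (g ` {0..L})" using g_cont by (intro connected_continuous_image) auto
    then have "0 \<in> g ` {0..L}"
      using connectedD_interval[of "g ` {0..L}" "g x" "g y" 0] xy by auto
    then show False using g_ne by auto
  qed
  then show False
  proof
    assume "\<forall>s\<in>{0..L}. g s \<ge> 0"
    then show False
      using has_integral_0_cbox_imp_0[of 0 L g 0] g_int g_cont g_ne[of 0] \<open>L > 0\<close> by auto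
  next
    assume "\<forall>s\<in>{0..L}. g s \<le> 0"
    then show False
      using has_integral_0_cbox_imp_0[of 0 L "\<lambda>s. - g s" 0] has_integral_neg[OF g_int] g_cont g_ne[of 0] \<open>L > 0\<close>
      by (auto intro: continuous_intros)
  qed
qed

text \<open>Cramer's rule; it makes the multipliers quotients of integrals, from which their
  continuity in time can be read off.\<close>

lemma matrix_inv_mult_vector_2:
  fixes A :: "real ^ 2 ^ 2"
  assumes "det A \<noteq> 0"
  shows "(matrix_inv A *v x) $ 1 = (A $ 2 $ 2 * x $ 1 - A $ 1 $ 2 * x $ 2) / det A"
    and "(matrix_inv A *v x) $ 2 = (A $ 1 $ 1 * x $ 2 - A $ 2 $ 1 * x $ 1) / det A"
proof -
  define y where "y = matrix_inv A *v x"
  have "A ** matrix_inv A = mat 1"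
    using assms someI_ex[of "\<lambda>A'. A ** A' = mat 1 \<and> A' ** A = mat 1"]
    by (simp add: matrix_inv_def invertible_def flip: invertible_det_nz)
  then have "A *v y = x" by (simp add: y_def matrix_vector_mul_assoc)
  then have "x $ 1 = A $ 1 $ 1 * y $ 1 + A $ 1 $ 2 * y $ 2" "x $ 2 = A $ 2 $ 1 * y $ 1 + A $ 2 $ 2 * y $ 2"
    by (auto simp: matrix_vector_mult_def sum_2)
  then have "A $ 2 $ 2 * x $ 1 - A $ 1 $ 2 * x $ 2 = det A * y $ 1"
    "A $ 1 $ 1 * x $ 2 - A $ 2 $ 1 * x $ 1 = det A * y $ 2"
    by (simp_all add: det_2 algebra_simps)
  then show "(matrix_inv A *v x) $ 1 = (A $ 2 $ 2 * x $ 1 - A $ 1 $ 2 * x $ 2) / det A"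
    "(matrix_inv A *v x) $ 2 = (A $ 1 $ 1 * x $ 2 - A $ 2 $ 1 * x $ 1) / det A"
    using assms by (simp_all add: y_def)
qed

lemma continuous_on_integral_Icc:
  fixes f :: "'a :: topological_space \<Rightarrow> real \<Rightarrow> real"
  assumes "continuous_on (U \<times> {a..b}) (\<lambda>p. f (fst p) (snd p))"
  shows "continuous_on U (\<lambda>t. integral {a..b} (f t))"
  using integral_continuous_on_param[of U a b f] assms by (simp add: split_beta)

lemma lambda_theta_continuous_on:
  fixes U :: "real set"
  assumes \<theta>: "continuous_on (U \<times> {0..L}) (\<lambda>p. \<theta> (fst p) (snd p))"
    and \<kappa>: "continuous_on (U \<times> {0..L}) (\<lambda>p. sderiv L (\<theta> (fst p)) (snd p))"
    and \<rho>: "continuous_on (U \<times> {0..L}) (\<lambda>p. \<rho> (fst p) (snd p))"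
    and \<beta>: "continuous_on UNIV \<beta>"
    and det: "\<And>t. t \<in> U \<Longrightarrow> det (Pi_matrix L (\<theta> t)) \<noteq> 0"
  shows "continuous_on U (\<lambda>t. lambda_theta L c0 \<beta> (\<theta> t) (\<rho> t) $ 1)"
    and "continuous_on U (\<lambda>t. lambda_theta L c0 \<beta> (\<theta> t) (\<rho> t) $ 2)"
proof -
  have \<beta>\<rho>: "continuous_on (U \<times> {0..L}) (\<lambda>p. \<beta> (\<rho> (fst p) (snd p)))"
    using continuous_on_compose2[OF \<beta> \<rho>] by simp
  have Pi: "continuous_on U (\<lambda>t. Pi_matrix L (\<theta> t) $ 1 $ 1)" "continuous_on U (\<lambda>t. Pi_matrix L (\<theta> t) $ 1 $ 2)"
    "continuous_on U (\<lambda>t. Pi_matrix L (\<theta> t) $ 2 $ 1)" "continuous_on U (\<lambda>t. Pi_matrix L (\<theta> t) $ 2 $ 2)"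
    unfolding Pi_matrix_def vector_2 by (intro continuous_on_integral_Icc continuous_intros \<theta>)+
  have F: "continuous_on U (\<lambda>t. integral {0..L} (\<lambda>s. cos (\<theta> t s) * sderiv L (\<theta> t) s * \<beta> (\<rho> t s) * (sderiv L (\<theta> t) s - c0)))"
    "continuous_on U (\<lambda>t. integral {0..L} (\<lambda>s. sin (\<theta> t s) * sderiv L (\<theta> t) s * \<beta> (\<rho> t s) * (sderiv L (\<theta> t) s - c0)))"
    by (intro continuous_on_integral_Icc continuous_intros \<theta> \<kappa> \<beta>\<rho>)+
  have D: "continuous_on U (\<lambda>t. det (Pi_matrix L (\<theta> t)))"
    unfolding det_2 by (intro continuous_intros Pi)
  show "continuous_on U (\<lambda>t. lambda_theta L c0 \<beta> (\<theta> t) (\<rho> t) $ 1)"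
    using det by (auto simp: lambda_theta_def matrix_inv_mult_vector_2 cong: continuous_on_cong
        intro!: continuous_on_divide continuous_on_diff continuous_on_mult Pi F D)
  show "continuous_on U (\<lambda>t. lambda_theta L c0 \<beta> (\<theta> t) (\<rho> t) $ 2)"
    using det by (auto simp: lambda_theta_def matrix_inv_mult_vector_2 cong: continuous_on_cong
        intro!: continuous_on_divide continuous_on_diff continuous_on_mult Pi F D)
qed

section \<open>Preservation of the sign of the curvature\<close>

lemma sderiv_cong:
  assumes "\<And>x. x \<in> {0..L} \<Longrightarrow> f x = g x" "s \<in> {0..L}"
  shows "sderiv L f s = sderiv L g s"
  unfolding sderiv_def
  by (rule vector_derivative_cong_eq) (use assms in \<open>auto intro!: always_eventually\<close>)

text \<open>The factor \<open>\<sigma>\<close> treats both signs at once, since the equation for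
  \<open>u\<close> is linear. The time \<open>t\<close> in question serves as the horizon, which
  makes the space-time domain compact.\<close>

lemma flow_curvature_sign:
  fixes \<sigma> :: real
  assumes "L > 0" and "smooth_real \<beta>" and \<beta>_pos: "\<And>x. \<beta> x > 0"
    and adm: "admissible_datum L \<nu> \<omega> \<theta>0 \<rho>0"
    and sol: "global_solution L \<mu> \<omega> 0 \<beta> \<theta>0 \<rho>0 \<theta> \<rho>"
    and ts: "t \<ge> 0" "s \<in> {0..L}"
  shows "(\<And>x. x \<in> {0..L} \<Longrightarrow> \<sigma> * curvature L \<theta>0 x \<ge> 0) \<Longrightarrow> \<sigma> * curvature L (\<theta> t) s \<ge> 0"
    and "(\<And>x. x \<in> {0..L} \<Longrightarrow> \<sigma> * curvature L \<theta>0 x > 0) \<Longrightarrow> \<sigma> * curvature L (\<theta> t) s > 0"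
proof -
  let ?k = "\<lambda>\<tau>. sderiv L (\<theta> \<tau>)"
  let ?S = "{0..t} \<times> {0..L}"
  define l1 where "l1 \<tau> = lambda_theta L 0 \<beta> (\<theta> \<tau>) (\<rho> \<tau>) $ 1" for \<tau>
  define l2 where "l2 \<tau> = lambda_theta L 0 \<beta> (\<theta> \<tau>) (\<rho> \<tau>) $ 2" for \<tau>
  define \<Lambda> where "\<Lambda> \<tau> x = l1 \<tau> * cos (\<theta> \<tau> x) + l2 \<tau> * sin (\<theta> \<tau> x)" for \<tau> x
  \<comment> \<open>The right-hand side of the density equation replaces
    \<open>tderiv \<rho>\<close>, because it is continuous up to time 0.\<close>
  define \<rho>t where "\<rho>t \<tau> x = \<mu> * sderiv L (sderiv L (\<rho> \<tau>)) x - 1 / 2 * deriv \<beta> (\<rho> \<tau> x) * (?k \<tau> x)\<^sup>2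
      - lambda_rho L 0 \<beta> (\<theta> \<tau>) (\<rho> \<tau>)" for \<tau> x
  define u where "u \<tau> x = \<sigma> * (\<beta> (\<rho> \<tau> x) * ?k \<tau> x)" for \<tau> x
  \<comment> \<open>The flux is expressed through the equation for \<open>\<theta>\<close>, so that
    its spatial derivative \<open>uxx\<close> involves only \<open>tderiv ?k\<close> and first
    derivatives of \<open>\<theta>\<close>.\<close>
  define ux where "ux \<tau> x = \<sigma> * (tderiv \<theta> \<tau> x - l1 \<tau> * sin (\<theta> \<tau> x) + l2 \<tau> * cos (\<theta> \<tau> x))" for \<tau> x
  define uxx where "uxx \<tau> x = \<sigma> * (tderiv ?k \<tau> x - \<Lambda> \<tau> x * ?k \<tau> x)" for \<tau> x
  define c where "c \<tau> x = deriv \<beta> (\<rho> \<tau> x) * \<rho>t \<tau> x / \<beta> (\<rho> \<tau> x) + \<Lambda> \<tau> x" for \<tau> x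

  have \<beta>_diff: "(\<beta> has_real_derivative deriv \<beta> x) (at x)" and \<beta>'_diff: "deriv \<beta> differentiable (at x)" for x
  proof -
    have "((deriv ^^ k) \<beta>) differentiable (at x)" for k
      using \<open>smooth_real \<beta>\<close> by (auto simp: smooth_real_def differentiable_on_def)
    from this[of 0] this[of 1] show "(\<beta> has_real_derivative deriv \<beta> x) (at x)" "deriv \<beta> differentiable (at x)"
      by (auto simp: DERIV_deriv_iff_real_differentiable)
  qed
  have \<beta>_cont: "continuous_on UNIV \<beta>" "continuous_on UNIV (deriv \<beta>)"
    using DERIV_isCont[OF \<beta>_diff] differentiable_imp_continuous_within[OF \<beta>'_diff]
    by (auto intro!: continuous_at_imp_continuous_on)

  have smooth: "smooth_strip L \<theta>" "smooth_strip L \<rho>" and C0: "C0_C2 L \<theta>" "C0_C2 L \<rho>"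
    using sol by (auto simp: global_solution_def)
  have diff: "(\<lambda>(t, s). (sderiv L ^^ j) (w t) s) differentiable_on {0<..} \<times> {0..L}"
    if "smooth_strip L w" for j w
    using that[unfolded smooth_strip_def, rule_format, of 0 j] by simp
  note \<theta>_diff = diff[OF smooth(1), of 0, simplified] and \<kappa>_diff = diff[OF smooth(1), of 1, simplified]
    and \<rho>_diff = diff[OF smooth(2), of 0, simplified]
  have joint: "continuous_on ?S (\<lambda>p. (sderiv L ^^ j) (w (fst p)) (snd p))"
    if "C0_C2 L w" "j \<le> 2" for w j
    by (rule continuous_on_subset[OF C0_C2_continuous_on[OF that, unfolded split_beta]]) auto
  have \<theta>_cont: "continuous_on ?S (\<lambda>p. \<theta> (fst p) (snd p))" using joint[OF C0(1), of 0] by simp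
  have \<kappa>_cont: "continuous_on ?S (\<lambda>p. ?k (fst p) (snd p))" using joint[OF C0(1), of 1] by simp
  have \<rho>_cont: "continuous_on ?S (\<lambda>p. \<rho> (fst p) (snd p))" using joint[OF C0(2), of 0] by simp
  have \<rho>ss_cont: "continuous_on ?S (\<lambda>p. sderiv L (sderiv L (\<rho> (fst p))) (snd p))"
    using joint[OF C0(2), of 2] by (simp add: numeral_2_eq_2)
  have \<beta>\<rho>_cont: "continuous_on ?S (\<lambda>p. \<beta> (\<rho> (fst p) (snd p)))" "continuous_on ?S (\<lambda>p. deriv \<beta> (\<rho> (fst p) (snd p)))"
    using continuous_on_compose2[OF \<beta>_cont(1) \<rho>_cont] continuous_on_compose2[OF \<beta>_cont(2) \<rho>_cont] by auto

  have init: "\<theta> 0 x = \<theta>0 x" if "x \<in> {0..L}" for x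
    using sol that by (simp add: global_solution_def)
  \<comment> \<open>\<open>\<theta> 0\<close> and \<open>\<theta>0\<close> agree only on the
    interval, which is all that the derivative within it sees.\<close>
  have \<kappa>_init: "?k 0 x = sderiv L \<theta>0 x" if "x \<in> {0..L}" for x
    using sderiv_cong[OF init that] .

  \<comment> \<open>Invertibility belongs to the notion of solution for positive times; at time 0 it
    comes from the closedness of the initial curve.\<close>
  have det: "det (Pi_matrix L (\<theta> \<tau>)) \<noteq> 0" if "\<tau> \<in> {0..t}" for \<tau>
  proof (cases "\<tau> = 0")
    case True
    have "integral {0..L} (\<lambda>s. sin (\<theta> 0 s)) = integral {0..L} (\<lambda>s. sin (\<theta>0 s))"
      "integral {0..L} (\<lambda>s. cos (\<theta> 0 s)) = integral {0..L} (\<lambda>s. cos (\<theta>0 s))"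
      by (auto intro!: integral_cong simp: init)
    moreover have "continuous_on {0..L} (\<theta> 0)"
      using C0(1) by (auto simp: C0_C2_def C2_interval_def intro: differentiable_imp_continuous_on)
    ultimately show ?thesis
      using Pi_matrix_det_nonzero_of_closed[OF \<open>L > 0\<close>] adm True by (simp add: admissible_datum_def)
  next
    case False
    then show ?thesis using sol that by (simp add: global_solution_def flip: invertible_det_nz)
  qed
  have l_cont: "continuous_on ?S (\<lambda>p. l1 (fst p))" "continuous_on ?S (\<lambda>p. l2 (fst p))"
    unfolding l1_def l2_def
    using lambda_theta_continuous_on[OF \<theta>_cont \<kappa>_cont \<rho>_cont \<beta>_cont(1) det, of 0]
    by (auto elim!: continuous_on_compose2 intro: continuous_intros)
  have "continuous_on {0..t} (\<lambda>\<tau>. lambda_rho L 0 \<beta> (\<theta> \<tau>) (\<rho> \<tau>))"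
    unfolding lambda_rho_def
    by (intro continuous_intros continuous_on_integral_Icc \<beta>\<rho>_cont \<kappa>_cont)
  then have lr_cont: "continuous_on ?S (\<lambda>p. lambda_rho L 0 \<beta> (\<theta> (fst p)) (\<rho> (fst p)))"
    by (auto elim!: continuous_on_compose2 intro: continuous_intros)
  have "continuous_on ?S (\<lambda>p. c (fst p) (snd p))"
    unfolding c_def \<rho>t_def \<Lambda>_def
    using \<beta>_pos by (intro continuous_intros \<beta>\<rho>_cont \<kappa>_cont \<theta>_cont \<rho>ss_cont l_cont lr_cont) (auto simp: less_imp_neq[symmetric])
  then have "compact ((\<lambda>p. c (fst p) (snd p)) ` ?S)"
    by (intro compact_continuous_image compact_Times) auto
  then obtain M where M: "\<bar>c \<tau> x\<bar> \<le> M" if "\<tau> \<in> {0..t}" "x \<in> {0..L}" for \<tau> x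
    by (force dest!: compact_imp_bounded simp: bounded_iff)

  have pde_\<theta>: "tderiv \<theta> \<tau> x = sderiv L (\<lambda>x. \<beta> (\<rho> \<tau> x) * ?k \<tau> x) x + l1 \<tau> * sin (\<theta> \<tau> x) - l2 \<tau> * cos (\<theta> \<tau> x)"
    if "\<tau> > 0" "x \<in> {0..L}" for \<tau> x
    using sol that by (simp add: global_solution_def l1_def l2_def)
  have pde_\<rho>: "tderiv \<rho> \<tau> x = \<rho>t \<tau> x" if "\<tau> > 0" "x \<in> {0..L}" for \<tau> x
    using sol that by (simp add: global_solution_def \<rho>t_def)
  have bc: "\<theta> \<tau> L = \<theta> \<tau> 0 + 2 * pi * of_int \<omega>" "\<rho> \<tau> L = \<rho> \<tau> 0" "?k \<tau> L = ?k \<tau> 0" if "\<tau> > 0" for \<tau>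
    using sol that by (auto simp: global_solution_def algebra_simps)

  have u_cont: "continuous_on ?S (\<lambda>(t, s). u t s)"
    unfolding u_def split_beta by (intro continuous_intros \<beta>\<rho>_cont \<kappa>_cont)
  have u_ux: "(u \<tau> has_real_derivative ux \<tau> x) (at x within {0..L})" if \<tau>: "\<tau> \<in> {0<..t}" and x: "x \<in> {0..L}" for \<tau> x
  proof -
    have "\<tau> > 0" using \<tau> by simp
    have "((\<lambda>x. \<beta> (\<rho> \<tau> x) * ?k \<tau> x) has_real_derivative
        deriv \<beta> (\<rho> \<tau> x) * sderiv L (\<rho> \<tau>) x * ?k \<tau> x + sderiv L (?k \<tau>) x * \<beta> (\<rho> \<tau> x)) (at x within {0..L})"
      by (intro DERIV_mult DERIV_chain2[OF \<beta>_diff] differentiable_on_strip_sderiv \<open>\<tau> > 0\<close> x \<rho>_diff \<kappa>_diff)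
    \<comment> \<open>The product rule provides differentiability; uniqueness of the derivative
      within the interval names it \<open>sderiv\<close>, the form in which it enters the equation
      for \<open>\<theta>\<close>.\<close>
    then have "((\<lambda>x. \<beta> (\<rho> \<tau> x) * ?k \<tau> x) has_real_derivative sderiv L (\<lambda>x. \<beta> (\<rho> \<tau> x) * ?k \<tau> x) x) (at x within {0..L})"
      using vector_derivative_within_closed_interval[OF \<open>L > 0\<close> x]
      by (metis has_real_derivative_iff_has_vector_derivative sderiv_def)
    then show ?thesis
      using pde_\<theta>[OF \<open>\<tau> > 0\<close> x] DERIV_cmult[of _ _ _ _ \<sigma>] unfolding u_def ux_def by fastforce
  qed
  have ux_uxx: "(ux \<tau> has_real_derivative uxx \<tau> x) (at x within {0..L})" if \<tau>: "\<tau> \<in> {0<..t}" and x: "x \<in> {0..L}" for \<tau> x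
  proof -
    have "\<tau> > 0" using \<tau> by simp
    show ?thesis
      unfolding ux_def uxx_def \<Lambda>_def
      by (auto intro!: derivative_eq_intros differentiable_on_strip_sderiv[OF \<theta>_diff \<open>\<tau> > 0\<close> x]
          smooth_strip_mixed_derivative[OF \<open>L > 0\<close> smooth(1) \<open>\<tau> > 0\<close> x] simp: algebra_simps)
  qed
  have u_t: "((\<lambda>\<tau>. u \<tau> x) has_real_derivative \<beta> (\<rho> \<tau> x) * uxx \<tau> x + c \<tau> x * u \<tau> x) (at \<tau>)"
    if \<tau>: "\<tau> \<in> {0<..t}" and x: "x \<in> {0..L}" for \<tau> x
  proof -
    have "\<tau> > 0" using \<tau> by simp
    have "((\<lambda>\<tau>. u \<tau> x) has_real_derivative
        \<sigma> * (deriv \<beta> (\<rho> \<tau> x) * tderiv \<rho> \<tau> x * ?k \<tau> x + tderiv ?k \<tau> x * \<beta> (\<rho> \<tau> x))) (at \<tau>)"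
      unfolding u_def
      by (intro DERIV_cmult DERIV_mult DERIV_chain2[OF \<beta>_diff] 
          differentiable_on_strip_tderiv[OF \<rho>_diff \<open>\<tau> > 0\<close> x] differentiable_on_strip_tderiv[OF \<kappa>_diff \<open>\<tau> > 0\<close> x])
    \<comment> \<open>The \<open>\<Lambda>\<close> terms of \<open>uxx\<close> and \<open>c\<close>
      cancel.\<close>
    moreover have "\<sigma> * (deriv \<beta> (\<rho> \<tau> x) * tderiv \<rho> \<tau> x * ?k \<tau> x + tderiv ?k \<tau> x * \<beta> (\<rho> \<tau> x)) =
        \<beta> (\<rho> \<tau> x) * uxx \<tau> x + c \<tau> x * u \<tau> x"
      using \<beta>_pos[of "\<rho> \<tau> x"] unfolding pde_\<rho>[OF \<open>\<tau> > 0\<close> x] uxx_def c_def u_def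
      by (simp add: field_simps)
    ultimately show ?thesis by simp
  qed
  have u_per: "u \<tau> L = u \<tau> 0" if "\<tau> \<in> {0<..t}" for \<tau>
    using bc[of \<tau>] that by (simp add: u_def)
  \<comment> \<open>The flux \<open>\<partial>\<^sub>s(\<beta>(\<rho>) \<kappa>)\<close> is periodic because the equation expresses it through \<open>\<partial>\<^sub>t\<theta>\<close>;
    no boundary condition on \<open>\<partial>\<^sub>s\<kappa>\<close> is imposed.\<close>
  have ux_per: "ux \<tau> L = ux \<tau> 0" if "\<tau> \<in> {0<..t}" for \<tau>
  proof -
    have "\<tau> > 0" using that by simp
    have "((\<lambda>\<tau>. \<theta> \<tau> L - \<theta> \<tau> 0) has_real_derivative tderiv \<theta> \<tau> L - tderiv \<theta> \<tau> 0) (at \<tau>)"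
      using \<open>L > 0\<close> by (intro DERIV_diff differentiable_on_strip_tderiv[OF \<theta>_diff \<open>\<tau> > 0\<close>]) auto
    moreover have "((\<lambda>\<tau>. \<theta> \<tau> L - \<theta> \<tau> 0) has_real_derivative 0) (at \<tau>)"
      by (rule has_field_derivative_transform_within_open[of "\<lambda>_. 2 * pi * of_int \<omega>" _ _ "{0<..}"])
        (use \<open>\<tau> > 0\<close> bc in auto)
    ultimately have "tderiv \<theta> \<tau> L = tderiv \<theta> \<tau> 0" using DERIV_unique by fastforce
    then show ?thesis
      by (simp add: ux_def bc[OF \<open>\<tau> > 0\<close>] sin_add cos_add)
  qed

  have \<beta>\<rho>_nonneg: "0 \<le> \<beta> (\<rho> \<tau> x)" if "\<tau> \<in> {0<..t}" "x \<in> {0..L}" for \<tau> x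
    using \<beta>_pos by (simp add: less_imp_le)
  have c_bound: "\<bar>c \<tau> x\<bar> \<le> M" if "\<tau> \<in> {0<..t}" "x \<in> {0..L}" for \<tau> x
    using M that by simp
  have t_in: "t \<in> {0..t}" using ts(1) by simp
  have u_eq: "u \<tau> x = \<beta> (\<rho> \<tau> x) * (\<sigma> * ?k \<tau> x)" for \<tau> x by (simp add: u_def)
  {
    assume "\<And>x. x \<in> {0..L} \<Longrightarrow> \<sigma> * curvature L \<theta>0 x \<ge> 0"
    then have u0: "u 0 x \<ge> 0" if "x \<in> {0..L}" for x
      using \<beta>_pos[of "\<rho> 0 x"] that by (simp add: u_eq \<kappa>_init)
    have "u t s \<ge> 0"
      by (rule periodic_linear_parabolic_sign(1)[OF \<open>L > 0\<close> u_cont u_ux ux_uxx u_t u_per ux_per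
            \<beta>\<rho>_nonneg c_bound t_in ts(2) u0])
    then show "\<sigma> * curvature L (\<theta> t) s \<ge> 0"
      using \<beta>_pos[of "\<rho> t s"] by (metis u_eq mult_less_0_iff not_less)
  }
  {
    assume "\<And>x. x \<in> {0..L} \<Longrightarrow> \<sigma> * curvature L \<theta>0 x > 0"
    then have u0: "u 0 x > 0" if "x \<in> {0..L}" for x
      using \<beta>_pos[of "\<rho> 0 x"] that by (simp add: u_eq \<kappa>_init)
    have "u t s > 0"
      by (rule periodic_linear_parabolic_sign(2)[OF \<open>L > 0\<close> u_cont u_ux ux_uxx u_t u_per ux_per
            \<beta>\<rho>_nonneg c_bound t_in ts(2) u0])
    then show "\<sigma> * curvature L (\<theta> t) s > 0"
      using \<beta>_pos[of "\<rho> t s"] by (metis u_eq zero_less_mult_pos)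
  }
qed

theorem theorem1p3:
  fixes L \<nu> \<mu> c0 :: real and \<omega> :: int
    and \<beta> \<theta>0 \<rho>0 :: "real \<Rightarrow> real"
    and \<theta> \<rho> :: "real \<Rightarrow> real \<Rightarrow> real"
  assumes "L > 0" and "\<mu> > 0"
    and "smooth_real \<beta>" and "\<And>x. \<beta> x > 0"
    and "c0 = 0"
    and "admissible_datum L \<nu> \<omega> \<theta>0 \<rho>0"
    and "global_solution L \<mu> \<omega> c0 \<beta> \<theta>0 \<rho>0 \<theta> \<rho>"
  shows
    "((\<forall>s\<in>{0..L}. curvature L \<theta>0 s \<ge> 0) \<longrightarrow> (\<forall>t\<ge>0. \<forall>s\<in>{0..L}. curvature L (\<theta> t) s \<ge> 0)) \<and>
     ((\<forall>s\<in>{0..L}. curvature L \<theta>0 s \<le> 0) \<longrightarrow> (\<forall>t\<ge>0. \<forall>s\<in>{0..L}. curvature L (\<theta> t) s \<le> 0)) \<and>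
     ((\<forall>s\<in>{0..L}. curvature L \<theta>0 s > 0) \<longrightarrow> (\<forall>t\<ge>0. \<forall>s\<in>{0..L}. curvature L (\<theta> t) s > 0)) \<and>
     ((\<forall>s\<in>{0..L}. curvature L \<theta>0 s < 0) \<longrightarrow> (\<forall>t\<ge>0. \<forall>s\<in>{0..L}. curvature L (\<theta> t) s < 0))"
proof -
  have sol: "global_solution L \<mu> \<omega> 0 \<beta> \<theta>0 \<rho>0 \<theta> \<rho>" using assms(5,7) by simp
  note sign = flow_curvature_sign[OF \<open>L > 0\<close> \<open>smooth_real \<beta>\<close> assms(4) \<open>admissible_datum _ _ _ _ _\<close> sol]
  show ?thesis
    using sign[where \<sigma> = 1] sign[where \<sigma> = "- 1"] by auto
qed

end
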